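(* Let $G$ be an inverse semigroup, and let $H=\{(A,t): A\subseteq G \text{ finite},\ t\in G,\ t,tt^*\in A,\ \text{and } ss^*=tt^* \text{ for all } s\in A\}$, with the product $(A,t)(B,s)=(tss^*t^*A\cup tB,\ ts)$ (under which $H$ is an inverse semigroup). Then $\mathbf{Pr}(G)$ is canonically isomorphic to $H$: the map sending an element $x=\varepsilon_A[t]\in\mathbf{Pr}(G)$ written in normal form to the pair $(A,t)$ is an isomorphism $\mathbf{Pr}(G)\cong H$. This map coincides with the homomorphism $\tilde\pi\colon\mathbf{Pr}(G)\to H$ satisfying $\tilde\pi([t])=\pi(t)$ for all $t\in G$, where $\pi\colon G\to H$ is the partial homomorphism $\pi(t)=(\{tt^*,t\},t)$.
   Context: For an inverse semigroup $G$, $s^*$ denotes the inverse of $s\in G$ and $E(G)$ the set of idempotents. $\mathbf{Pr}(G)$ denotes the universal semigroup with one generator $[s]$ for each $s\in G$ and, for all $s,t\in G$, the relations (i) $[s][t][t^*]=[st][t^*]$; (ii) $[s^*][s][t]=[s^*][st]$; (iii) $[s][s^*][s]=[s]$. For $s\in G$ put $\varepsilon_s=[s][s^*]$; these elements are idempotents that commute with each other, so for a finite set $A=\{s_1,\dots,s_n\}\subseteq G$ one may define $\varepsilon_A=\varepsilon_{s_1}\cdots\varepsilon_{s_n}$. Every element of $\mathbf{Pr}(G)$ can be written in normal form, i.e. as $\varepsilon_A[t]$ with $t\in G$ and $A\subseteq G$ a finite set such that $t,tt^*\in A$ and $ss^*=tt^*$ for all $s\in A$. A map $\pi$ from $G$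 to a semigroup $T$ is a partial homomorphism if for all $s,t\in G$: $\pi(s)\pi(t)\pi(t^* )=\pi(st)\pi(t^* )$, $\pi(s^* )\pi(s)\pi(t)=\pi(s^* )\pi(st)$, and $\pi(s)\pi(s^* )\pi(s)=\pi(s)$. By the universal property of $\mathbf{Pr}(G)$, each partial homomorphism $\pi\colon G\to T$ yields a unique semigroup homomorphism $\tilde\pi\colon\mathbf{Pr}(G)\to T$ with $\tilde\pi([s])=\pi(s)$. For $t\in G$, $B\subseteq G$, $tB=\{tb:b\in B\}$. *)

theory Defs
  imports "HOL-Algebra.Congruence" "HOL-Library.FuncSet"
begin

record 'a magma = "'a partial_object" +
  mul :: "'a \<Rightarrow> 'a \<Rightarrow> 'a" (infixl "\<cdot>\<index>" 70)

locale semigrp = fixes S (structure)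
  assumes mul_closed [intro, simp]:
      "\<lbrakk>x \<in> carrier S; y \<in> carrier S\<rbrakk> \<Longrightarrow> x \<cdot> y \<in> carrier S"
    and mul_assoc:
      "\<lbrakk>x \<in> carrier S; y \<in> carrier S; z \<in> carrier S\<rbrakk> \<Longrightarrow> x \<cdot> y \<cdot> z = x \<cdot> (y \<cdot> z)"

locale inverse_semigrp = semigrp G for G (structure) +
  assumes inverse_ex1:
    "s \<in> carrier G \<Longrightarrow> \<exists>!t. t \<in> carrier G \<and> s \<cdot> t \<cdot> s = s \<and> t \<cdot> s \<cdot> t = t"

definition star :: "('a, 'b) magma_scheme \<Rightarrow> 'a \<Rightarrow> 'a" ("star\<index> _" [81] 80)
  where "star\<^bsub>G\<^esub> s =
    (THE t. t \<in> carrier G \<and> s \<cdot>\<^bsub>G\<^esub> t \<cdot>\<^bsub>G\<^esub> s = s \<and> t \<cdot>\<^bsub>G\<^esub> s \<cdot>\<^bsub>G\<^esub> t = t)"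

definition semigrp_hom ::
    "('a, 'c) magma_scheme \<Rightarrow> ('b, 'd) magma_scheme \<Rightarrow> ('a \<Rightarrow> 'b) set"
  where "semigrp_hom S T = {f \<in> carrier S \<rightarrow> carrier T.
    \<forall>x\<in>carrier S. \<forall>y\<in>carrier S. f (x \<cdot>\<^bsub>S\<^esub> y) = f x \<cdot>\<^bsub>T\<^esub> f y}"

definition semigrp_iso ::
    "('a, 'c) magma_scheme \<Rightarrow> ('b, 'd) magma_scheme \<Rightarrow> ('a \<Rightarrow> 'b) set"
  where "semigrp_iso S T = {f \<in> semigrp_hom S T. bij_betw f (carrier S) (carrier T)}"

definition partial_hom ::
    "('a, 'c) magma_scheme \<Rightarrow> ('b, 'd) magma_scheme \<Rightarrow> ('a \<Rightarrow> 'b) \<Rightarrow> bool"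
  where "partial_hom G T p \<longleftrightarrow> p \<in> carrier G \<rightarrow> carrier T \<and>
    (\<forall>s\<in>carrier G. \<forall>t\<in>carrier G.
       p s \<cdot>\<^bsub>T\<^esub> p t \<cdot>\<^bsub>T\<^esub> p (star\<^bsub>G\<^esub> t) = p (s \<cdot>\<^bsub>G\<^esub> t) \<cdot>\<^bsub>T\<^esub> p (star\<^bsub>G\<^esub> t) \<and>
       p (star\<^bsub>G\<^esub> s) \<cdot>\<^bsub>T\<^esub> p s \<cdot>\<^bsub>T\<^esub> p t = p (star\<^bsub>G\<^esub> s) \<cdot>\<^bsub>T\<^esub> p (s \<cdot>\<^bsub>G\<^esub> t) \<and>
       p s \<cdot>\<^bsub>T\<^esub> p (star\<^bsub>G\<^esub> s) \<cdot>\<^bsub>T\<^esub> p s = p s)"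

text \<open>
  The free semigroup on the carrier of \<open>G\<close> consists of the nonempty words over it, under
  concatenation; the semigroup presented by the three families of relations is its quotient by
  the least congruence containing them.
\<close>

definition words :: "('a, 'c) magma_scheme \<Rightarrow> 'a list set"
  where "words G = {w. w \<noteq> [] \<and> set w \<subseteq> carrier G}"

inductive Pr_eq :: "('a, 'c) magma_scheme \<Rightarrow> 'a list \<Rightarrow> 'a list \<Rightarrow> bool"
  for G (structure) where
  rel_i: "\<lbrakk>s \<in> carrier G; t \<in> carrier G\<rbrakk> \<Longrightarrow> Pr_eq G [s, t, star t] [s \<cdot> t, star t]"
| rel_ii: "\<lbrakk>s \<in> carrier G; t \<in> carrier G\<rbrakk> \<Longrightarrow> Pr_eq G [star s, s, t] [star s, s \<cdot> t]"
| rel_iii: "s \<in> carrier G \<Longrightarrow> Pr_eq G [s, star s, s] [s]"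
| Pr_refl: "w \<in> words G \<Longrightarrow> Pr_eq G w w"
| Pr_sym: "Pr_eq G u v \<Longrightarrow> Pr_eq G v u"
| Pr_trans: "\<lbrakk>Pr_eq G u v; Pr_eq G v w\<rbrakk> \<Longrightarrow> Pr_eq G u w"
| Pr_append: "\<lbrakk>Pr_eq G u v; Pr_eq G u' v'\<rbrakk> \<Longrightarrow> Pr_eq G (u @ u') (v @ v')"

definition Pr_rel :: "('a, 'c) magma_scheme \<Rightarrow> ('a list \<times> 'a list) set"
  where "Pr_rel G = {(u, v). Pr_eq G u v}"

definition Pr :: "('a, 'c) magma_scheme \<Rightarrow> 'a list set magma"
  where "Pr G = \<lparr>carrier = words G // Pr_rel G,
    mul = \<lambda>X Y. \<Union>u\<in>X. \<Union>v\<in>Y. Pr_rel G `` {u @ v}\<rparr>"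

definition gen :: "('a, 'c) magma_scheme \<Rightarrow> 'a \<Rightarrow> 'a list set"
  where "gen G s = Pr_rel G `` {[s]}"

definition is_induced ::
    "('a, 'c) magma_scheme \<Rightarrow> ('b, 'd) magma_scheme \<Rightarrow> ('a \<Rightarrow> 'b) \<Rightarrow> ('a list set \<Rightarrow> 'b) \<Rightarrow> bool"
  where "is_induced G T p f \<longleftrightarrow> f \<in> semigrp_hom (Pr G) T \<and> (\<forall>s\<in>carrier G. f (gen G s) = p s)"

definition translate :: "('a, 'c) magma_scheme \<Rightarrow> 'a \<Rightarrow> 'a set \<Rightarrow> 'a set"
  where "translate G t B = (\<lambda>b. t \<cdot>\<^bsub>G\<^esub> b) ` B"

definition pairs :: "('a, 'c) magma_scheme \<Rightarrow> ('a set \<times> 'a) magma"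
  where "pairs G = \<lparr>
    carrier = {(A, t). finite A \<and> A \<subseteq> carrier G \<and> t \<in> carrier G \<and>
      t \<in> A \<and> t \<cdot>\<^bsub>G\<^esub> star\<^bsub>G\<^esub> t \<in> A \<and>
      (\<forall>s\<in>A. s \<cdot>\<^bsub>G\<^esub> star\<^bsub>G\<^esub> s = t \<cdot>\<^bsub>G\<^esub> star\<^bsub>G\<^esub> t)},
    mul = \<lambda>(A, t) (B, s).
      (translate G (t \<cdot>\<^bsub>G\<^esub> s \<cdot>\<^bsub>G\<^esub> star\<^bsub>G\<^esub> s \<cdot>\<^bsub>G\<^esub> star\<^bsub>G\<^esub> t) A \<union> translate G t B, t \<cdot>\<^bsub>G\<^esub> s)\<rparr>"

definition pair_rep :: "('a, 'c) magma_scheme \<Rightarrow> 'a \<Rightarrow> 'a set \<times> 'a"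
  where "pair_rep G t = ({t \<cdot>\<^bsub>G\<^esub> star\<^bsub>G\<^esub> t, t}, t)"

definition eps :: "('a, 'c) magma_scheme \<Rightarrow> 'a \<Rightarrow> 'a list set"
  where "eps G s = gen G s \<cdot>\<^bsub>Pr G\<^esub> gen G (star\<^bsub>G\<^esub> s)"

text \<open>A semigroup has no unit to start from, so only products of nonempty lists are meaningful.\<close>

fun list_prod :: "('a, 'c) magma_scheme \<Rightarrow> 'a list \<Rightarrow> 'a" where
  "list_prod S [] = undefined"
| "list_prod S [x] = x"
| "list_prod S (x # y # zs) = x \<cdot>\<^bsub>S\<^esub> list_prod S (y # zs)"

text \<open>
  As the elements \<open>eps G s\<close> commute, \<open>is_eps_set G A e\<close> determines \<open>e\<close> when \<open>A\<close> is a finite nonempty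
  subset of the carrier. Phrasing it as a relation makes every enumeration of \<open>A\<close> admissible
  without invoking this fact in the definition.
\<close>

definition is_eps_set :: "('a, 'c) magma_scheme \<Rightarrow> 'a set \<Rightarrow> 'a list set \<Rightarrow> bool"
  where "is_eps_set G A e \<longleftrightarrow>
    (\<exists>ss. distinct ss \<and> set ss = A \<and> e = list_prod (Pr G) (map (eps G) ss))"

definition is_normal_form :: "('a, 'c) magma_scheme \<Rightarrow> 'a list set \<Rightarrow> 'a set \<times> 'a \<Rightarrow> bool"
  where "is_normal_form G x p \<longleftrightarrow> (case p of (A, t) \<Rightarrow>
    finite A \<and> A \<subseteq> carrier G \<and> t \<in> carrier G \<and>
    t \<in> A \<and> t \<cdot>\<^bsub>G\<^esub> star\<^bsub>G\<^esub> t \<in> A \<and>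
    (\<forall>s\<in>A. s \<cdot>\<^bsub>G\<^esub> star\<^bsub>G\<^esub> s = t \<cdot>\<^bsub>G\<^esub> star\<^bsub>G\<^esub> t) \<and>
    (\<exists>e. is_eps_set G A e \<and> x = e \<cdot>\<^bsub>Pr G\<^esub> gen G t))"

definition nf_map :: "('a, 'c) magma_scheme \<Rightarrow> 'a list set \<Rightarrow> 'a set \<times> 'a"
  where "nf_map G x = (THE p. is_normal_form G x p)"

context inverse_semigrp begin

lemma star_closed [intro, simp]: "s \<in> carrier G \<Longrightarrow> star s \<in> carrier G"
  unfolding star_def using theI'[OF inverse_ex1] by blast

lemma Pr_eq_words: "Pr_eq G u v \<Longrightarrow> u \<in> words G \<and> v \<in> words G"
  by (induction rule: Pr_eq.induct) (auto simp: words_def)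

lemma equiv_Pr_rel: "equiv (words G) (Pr_rel G)"
  unfolding equiv_def refl_on_def sym_def trans_def Pr_rel_def
  using Pr_eq_words by (auto intro: Pr_refl Pr_sym Pr_trans)

lemma Pr_mul_class:
  assumes "u \<in> words G" "v \<in> words G"
  shows "(Pr_rel G `` {u}) \<cdot>\<^bsub>Pr G\<^esub> (Pr_rel G `` {v}) = Pr_rel G `` {u @ v}"
proof -
  have "Pr_rel G `` {u' @ v'} = Pr_rel G `` {u @ v}"
    if "u' \<in> Pr_rel G `` {u}" "v' \<in> Pr_rel G `` {v}" for u' v'
  proof -
    have "(u @ v, u' @ v') \<in> Pr_rel G"
      using that by (simp add: Pr_rel_def Pr_append)
    then show ?thesis by (rule equiv_class_eq[OF equiv_Pr_rel, symmetric])
  qed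
  moreover have "u \<in> Pr_rel G `` {u}" "v \<in> Pr_rel G `` {v}"
    using assms by (simp_all add: Pr_rel_def Pr_refl)
  ultimately have "(\<Union>u'\<in>Pr_rel G `` {u}. \<Union>v'\<in>Pr_rel G `` {v}. Pr_rel G `` {u' @ v'}) =
      Pr_rel G `` {u @ v}"
    by blast
  then show ?thesis by (simp add: Pr_def)
qed

lemma Pr_carrier: "X \<in> carrier (Pr G) \<longleftrightarrow> (\<exists>w\<in>words G. X = Pr_rel G `` {w})"
  by (auto simp: Pr_def quotient_def)

lemma Pr_class_closed: "w \<in> words G \<Longrightarrow> Pr_rel G `` {w} \<in> carrier (Pr G)"
  unfolding Pr_carrier by blast

lemma words_append: "\<lbrakk>u \<in> words G; v \<in> words G\<rbrakk> \<Longrightarrow> u @ v \<in> words G"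
  by (auto simp: words_def)

lemma semigrp_Pr: "semigrp (Pr G)"
proof
  fix X Y assume "X \<in> carrier (Pr G)" "Y \<in> carrier (Pr G)"
  then show "X \<cdot>\<^bsub>Pr G\<^esub> Y \<in> carrier (Pr G)"
    using Pr_mul_class words_append unfolding Pr_carrier by metis
next
  fix X Y Z assume "X \<in> carrier (Pr G)" "Y \<in> carrier (Pr G)" "Z \<in> carrier (Pr G)"
  then obtain u v w where "u \<in> words G" "v \<in> words G" "w \<in> words G"
    "X = Pr_rel G `` {u}" "Y = Pr_rel G `` {v}" "Z = Pr_rel G `` {w}"
    unfolding Pr_carrier by blast
  then show "X \<cdot>\<^bsub>Pr G\<^esub> Y \<cdot>\<^bsub>Pr G\<^esub> Z = X \<cdot>\<^bsub>Pr G\<^esub> (Y \<cdot>\<^bsub>Pr G\<^esub> Z)"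
    by (simp add: Pr_mul_class words_append)
qed

lemma class_eq: "Pr_eq G u v \<Longrightarrow> Pr_rel G `` {u} = Pr_rel G `` {v}"
  using equiv_class_eq[OF equiv_Pr_rel] by (simp add: Pr_rel_def)

lemma partial_hom_gen: "partial_hom G (Pr G) (gen G)"
proof -
  have "[s] \<in> words G" if "s \<in> carrier G" for s
    using that by (simp add: words_def)
  moreover have "[s, t] \<in> words G" if "s \<in> carrier G" "t \<in> carrier G" for s t
    using that by (simp add: words_def)
  ultimately show ?thesis
    unfolding partial_hom_def gen_def
    by (auto simp: Pr_mul_class Pr_class_closed intro!: class_eq rel_i rel_ii rel_iii)
qed

lemma list_prod_append:
  assumes "semigrp T" "u \<noteq> []" "v \<noteq> []" "set u \<subseteq> carrier T" "set v \<subseteq> carrier T"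
  shows "list_prod T u \<in> carrier T \<and> list_prod T (u @ v) = list_prod T u \<cdot>\<^bsub>T\<^esub> list_prod T v"
proof -
  interpret T: semigrp T by fact
  have cl: "list_prod T w \<in> carrier T" if "w \<noteq> []" "set w \<subseteq> carrier T" for w
    using that
  proof (induction w rule: list_nonempty_induct)
    case (cons x xs)
    then show ?case by (cases xs) auto
  qed auto
  have "list_prod T (u @ v) = list_prod T u \<cdot>\<^bsub>T\<^esub> list_prod T v"
    using assms(2,4)
  proof (induction u rule: list_nonempty_induct)
    case (single x)
    then show ?case using assms(3) by (cases v) auto
  next
    case (cons x xs)
    then show ?case using cl[of xs] cl[of v] assms(3,5)
      by (cases xs) (auto simp: T.mul_assoc)
  qed
  with cl assms show ?thesis by blast
qed

lemma Pr_universal: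
  assumes T: "semigrp T" and p: "partial_hom G T p"
  shows "\<exists>f. is_induced G T p f"
    and "\<lbrakk>is_induced G T p f; is_induced G T p f'; x \<in> carrier (Pr G)\<rbrakk> \<Longrightarrow> f x = f' x"
proof -
  interpret T: semigrp T by fact
  let ?ev = "\<lambda>w. list_prod T (map p w)"
  have pc: "p s \<in> carrier T" if "s \<in> carrier G" for s
    using p that by (auto simp: partial_hom_def)
  have ev_append: "?ev u \<in> carrier T \<and> ?ev (u @ v) = ?ev u \<cdot>\<^bsub>T\<^esub> ?ev v"
    if "u \<in> words G" "v \<in> words G" for u v
    using list_prod_append[OF T, of "map p u" "map p v"] that pc
    by (auto simp: words_def)
  have ev_eq: "?ev u = ?ev v" if "Pr_eq G u v" for u v
    using that
  proof induction
    case (rel_i s t)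
    then show ?case using p pc by (simp add: partial_hom_def T.mul_assoc [symmetric])
  next
    case (rel_ii s t)
    then show ?case using p pc by (simp add: partial_hom_def T.mul_assoc [symmetric])
  next
    case (rel_iii s)
    then show ?case using p pc by (simp add: partial_hom_def T.mul_assoc [symmetric])
  next
    case (Pr_append u v u' v')
    then show ?case using ev_append Pr_eq_words by metis
  qed auto
  define f where "f X = ?ev (SOME w. w \<in> X)" for X
  have f: "f (Pr_rel G `` {w}) = ?ev w" if "w \<in> words G" for w
  proof -
    have "w \<in> Pr_rel G `` {w}" using that by (simp add: Pr_rel_def Pr_refl)
    then have "(SOME v. v \<in> Pr_rel G `` {w}) \<in> Pr_rel G `` {w}" by (rule someI)
    then show ?thesis unfolding f_def using ev_eq by (simp add: Pr_rel_def)
  qed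
  have "f \<in> semigrp_hom (Pr G) T"
    unfolding semigrp_hom_def using ev_append
    by (auto simp: Pr_carrier Pr_mul_class f words_append)
  moreover have "f (gen G s) = p s" if "s \<in> carrier G" for s
    using f[of "[s]"] that by (simp add: gen_def words_def)
  ultimately show "\<exists>f. is_induced G T p f" unfolding is_induced_def by blast
  have det: "g (Pr_rel G `` {w}) = ?ev w"
    if g: "is_induced G T p g" and "w \<noteq> []" "set w \<subseteq> carrier G" for g w
    using that(2,3)
  proof (induction w rule: list_nonempty_induct)
    case (single x)
    then show ?case using g by (simp add: is_induced_def gen_def)
  next
    case (cons x xs)
    then have w: "[x] \<in> words G" "xs \<in> words G" by (auto simp: words_def)
    have "g (Pr_rel G `` {[x]} \<cdot>\<^bsub>Pr G\<^esub> Pr_rel G `` {xs}) =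
        g (Pr_rel G `` {[x]}) \<cdot>\<^bsub>T\<^esub> g (Pr_rel G `` {xs})"
      using g Pr_class_closed[OF w(1)] Pr_class_closed[OF w(2)]
      unfolding is_induced_def semigrp_hom_def by blast
    then have "g (Pr_rel G `` {x # xs}) =
        g (Pr_rel G `` {[x]}) \<cdot>\<^bsub>T\<^esub> g (Pr_rel G `` {xs})"
      by (simp add: Pr_mul_class w)
    then show ?case using cons g w ev_append[of "[x]" xs]
      by (simp add: is_induced_def gen_def)
  qed
  show "f x = f' x"
    if "is_induced G T p f" "is_induced G T p f'" "x \<in> carrier (Pr G)" for f f' x
  proof -
    from that(3) obtain w where w: "w \<noteq> []" "set w \<subseteq> carrier G" "x = Pr_rel G `` {w}"
      unfolding Pr_carrier words_def by blast
    show ?thesis unfolding w(3) det[OF that(1) w(1,2)] det[OF that(2) w(1,2)] ..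
  qed
qed

end

end

theory Submission
  imports Defs
begin

text \<open>
  Write \<open>\<epsilon> s = [s][s*]\<close>. The rules \<open>[t] \<epsilon> s = \<epsilon> (ts) [t]\<close> and \<open>[s][t] = \<epsilon> s [st]\<close>, together with
  commutation of the \<open>\<epsilon> s\<close>, give \<open>[s] \<epsilon>\<^sub>A [t] = \<epsilon>\<^sub>C [st]\<close> where \<open>(C, st)\<close> is the product of
  \<open>({ss*, s}, s)\<close> and \<open>(A, t)\<close> in \<open>pairs G\<close>; hence every element has a normal form. Conversely the
  homomorphism induced by \<open>pair_rep G\<close> sends \<open>\<epsilon>\<^sub>A [t]\<close> to \<open>(A, t)\<close>, since multiplying by
  \<open>\<pi>(a)\<pi>(a*)\<close> on the left just adjoins \<open>a\<close> to the first component. So normal forms are unique and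
  the normal form map is that homomorphism.
\<close>

context inverse_semigrp begin

section \<open>Inverses and commuting idempotents in an inverse semigroup\<close>

lemma mul_star_mul:
  assumes "s \<in> carrier G"
  shows "s \<cdot> star s \<cdot> s = s" "star s \<cdot> s \<cdot> star s = star s"
  using theI'[OF inverse_ex1[OF assms]] unfolding star_def by blast+

lemma star_unique:
  assumes "s \<in> carrier G" "t \<in> carrier G" "s \<cdot> t \<cdot> s = s" "t \<cdot> s \<cdot> t = t"
  shows "star s = t"
  using inverse_ex1[OF assms(1)] assms mul_star_mul[OF assms(1)] by (metis star_closed)

lemma star_star [simp]: "s \<in> carrier G \<Longrightarrow> star (star s) = s"
  by (rule star_unique) (simp_all add: mul_star_mul)

lemma idem_star: "\<lbrakk>e \<in> carrier G; e \<cdot> e = e\<rbrakk> \<Longrightarrow> star e = e"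
  by (rule star_unique) simp_all

text \<open>Once \<open>mul_assoc\<close> has nested a product to the right, the cancellation
  pattern stands either at the end of a word or before a tail \<open>x\<close>. As simp rules the
  four forms settle most word identities below.\<close>

lemma star_cancel [simp]:
  assumes "s \<in> carrier G"
  shows "s \<cdot> (star s \<cdot> s) = s" "star s \<cdot> (s \<cdot> star s) = star s"
    and "x \<in> carrier G \<Longrightarrow> s \<cdot> (star s \<cdot> (s \<cdot> x)) = s \<cdot> x"
    and "x \<in> carrier G \<Longrightarrow> star s \<cdot> (s \<cdot> (star s \<cdot> x)) = star s \<cdot> x"
proof -
  show 1: "s \<cdot> (star s \<cdot> s) = s" "star s \<cdot> (s \<cdot> star s) = star s"
    using mul_star_mul[OF assms] assms by (simp_all add: mul_assoc)
  show "s \<cdot> (star s \<cdot> (s \<cdot> x)) = s \<cdot> x" "star s \<cdot> (s \<cdot> (star s \<cdot> x)) = star s \<cdot> x"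
    if "x \<in> carrier G"
    using that assms mul_star_mul[OF assms] by (metis mul_assoc mul_closed star_closed)+
qed

text \<open>If \<open>x\<close> is the inverse of \<open>e \<cdot> f\<close>, then so is
  \<open>f \<cdot> (x \<cdot> e)\<close>, hence the two agree. This makes \<open>x\<close>
  idempotent, therefore its own inverse, therefore equal to \<open>e \<cdot> f\<close>.\<close>

lemma idem_mul_idem:
  assumes e: "e \<in> carrier G" "e \<cdot> e = e" and f: "f \<in> carrier G" "f \<cdot> f = f"
  shows "e \<cdot> f \<cdot> (e \<cdot> f) = e \<cdot> f"
proof -
  define x where "x = star (e \<cdot> f)"
  have x: "x \<in> carrier G" unfolding x_def using e f by simp
  have ee: "e \<cdot> (e \<cdot> y) = e \<cdot> y" and ff: "f \<cdot> (f \<cdot> y) = f \<cdot> y" if "y \<in> carrier G" for y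
    using that e f by (simp_all add: mul_assoc[symmetric])
  have x1: "e \<cdot> (f \<cdot> (x \<cdot> (e \<cdot> f))) = e \<cdot> f" and x2: "x \<cdot> (e \<cdot> (f \<cdot> x)) = x"
    using mul_star_mul[of "e \<cdot> f"] e f x unfolding x_def[symmetric] by (simp_all add: mul_assoc)
  have x2': "x \<cdot> (e \<cdot> (f \<cdot> (x \<cdot> y))) = x \<cdot> y" if "y \<in> carrier G" for y
    using that e f x arg_cong[OF x2, of "\<lambda>z. z \<cdot> y"] by (simp add: mul_assoc)
  have "x = f \<cdot> (x \<cdot> e)"
    unfolding x_def using e f x
    by (intro star_unique) (simp_all add: x_def[symmetric] mul_assoc ee ff e f x1 x2')
  then have "x \<cdot> x = x"
    using e f x x2' by (metis mul_assoc mul_closed)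
  then have "star x = x" by (rule idem_star[OF x])
  then have "e \<cdot> f = x" using e f unfolding x_def by simp
  with \<open>x \<cdot> x = x\<close> show ?thesis by simp
qed

text \<open>Both \<open>e \<cdot> f\<close> and \<open>f \<cdot> e\<close> are idempotent, so
  \<open>f \<cdot> e\<close> is an inverse of \<open>e \<cdot> f\<close>. An idempotent is its own
  inverse as well, and inverses are unique.\<close>

lemma idem_commute:
  assumes e: "e \<in> carrier G" "e \<cdot> e = e" and f: "f \<in> carrier G" "f \<cdot> f = f"
  shows "e \<cdot> f = f \<cdot> e"
proof -
  have ee: "e \<cdot> (e \<cdot> y) = e \<cdot> y" and ff: "f \<cdot> (f \<cdot> y) = f \<cdot> y" if "y \<in> carrier G" for y
    using that e f by (simp_all add: mul_assoc[symmetric])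
  have 1: "e \<cdot> (f \<cdot> (e \<cdot> f)) = e \<cdot> f" and 2: "f \<cdot> (e \<cdot> (f \<cdot> e)) = f \<cdot> e"
    using idem_mul_idem e f by (simp_all add: mul_assoc[symmetric])
  have "star (e \<cdot> f) = f \<cdot> e"
    using e f by (intro star_unique) (simp_all add: mul_assoc ee ff 1 2)
  moreover have "star (e \<cdot> f) = e \<cdot> f"
    by (rule idem_star) (simp_all add: e f idem_mul_idem)
  ultimately show ?thesis by simp
qed

lemma mul_star_idem: "s \<in> carrier G \<Longrightarrow> s \<cdot> star s \<cdot> (s \<cdot> star s) = s \<cdot> star s"
  by (simp add: mul_assoc)

lemma star_mul_idem: "s \<in> carrier G \<Longrightarrow> star s \<cdot> s \<cdot> (star s \<cdot> s) = star s \<cdot> s"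
  by (simp add: mul_assoc)

text \<open>Commuting \<open>e\<close> past the idempotent \<open>star s \<cdot> s\<close> places
  the latter next to \<open>s\<close>, which absorbs it; likewise with
  \<open>s \<cdot> star s\<close> next to \<open>star s\<close>.\<close>

lemma idem_conj_cancel:
  assumes "s \<in> carrier G" "e \<in> carrier G" "e \<cdot> e = e"
  shows "s \<cdot> e \<cdot> star s \<cdot> s = s \<cdot> e" "star s \<cdot> e \<cdot> s \<cdot> star s = star s \<cdot> e"
proof -
  have "s \<cdot> (e \<cdot> (star s \<cdot> s)) = s \<cdot> e"
    using assms idem_commute[OF assms(2,3) _ star_mul_idem[OF assms(1)]] by (simp add: mul_assoc)
  moreover have "star s \<cdot> (e \<cdot> (s \<cdot> star s)) = star s \<cdot> e"
    using assms idem_commute[OF assms(2,3) _ mul_star_idem[OF assms(1)]] by (simp add: mul_assoc)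
  ultimately show "s \<cdot> e \<cdot> star s \<cdot> s = s \<cdot> e" "star s \<cdot> e \<cdot> s \<cdot> star s = star s \<cdot> e"
    using assms by (simp_all add: mul_assoc)
qed

text \<open>The case \<open>e = t \<cdot> star t\<close> of \<open>idem_conj_cancel\<close>,
  prepared as rewrite rules for right-nested words with and without a tail.\<close>

lemma conj_cancel [simp]:
  assumes "s \<in> carrier G" "t \<in> carrier G"
  shows "s \<cdot> (t \<cdot> (star t \<cdot> (star s \<cdot> s))) = s \<cdot> (t \<cdot> star t)"
    and "star s \<cdot> (t \<cdot> (star t \<cdot> (s \<cdot> star s))) = star s \<cdot> (t \<cdot> star t)"
    and "x \<in> carrier G \<Longrightarrow> s \<cdot> (t \<cdot> (star t \<cdot> (star s \<cdot> (s \<cdot> x)))) = s \<cdot> (t \<cdot> (star t \<cdot> x))"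
    and "x \<in> carrier G \<Longrightarrow> star s \<cdot> (t \<cdot> (star t \<cdot> (s \<cdot> (star s \<cdot> x)))) = star s \<cdot> (t \<cdot> (star t \<cdot> x))"
proof -
  note * = idem_conj_cancel[OF assms(1) _ mul_star_idem[OF assms(2)]]
  show "s \<cdot> (t \<cdot> (star t \<cdot> (star s \<cdot> s))) = s \<cdot> (t \<cdot> star t)"
    "star s \<cdot> (t \<cdot> (star t \<cdot> (s \<cdot> star s))) = star s \<cdot> (t \<cdot> star t)"
    using * assms by (simp_all add: mul_assoc)
  show "s \<cdot> (t \<cdot> (star t \<cdot> (star s \<cdot> (s \<cdot> x)))) = s \<cdot> (t \<cdot> (star t \<cdot> x))"
    "star s \<cdot> (t \<cdot> (star t \<cdot> (s \<cdot> (star s \<cdot> x)))) = star s \<cdot> (t \<cdot> (star t \<cdot> x))"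
    if "x \<in> carrier G"
    using that assms *[THEN arg_cong[of _ _ "\<lambda>z. z \<cdot> x"]] by (simp_all add: mul_assoc)
qed

text \<open>Swapping the idempotents \<open>t \<cdot> star t\<close> and
  \<open>star s \<cdot> s\<close> brings together \<open>s \<cdot> star s \<cdot> s\<close> and
  \<open>t \<cdot> star t \<cdot> t\<close>.\<close>

lemma star_mul [simp]:
  assumes "s \<in> carrier G" "t \<in> carrier G"
  shows "star (s \<cdot> t) = star t \<cdot> star s"
proof (rule star_unique)
  have "t \<cdot> (star t \<cdot> (star s \<cdot> (s \<cdot> t))) = star s \<cdot> (s \<cdot> t)"
    "star s \<cdot> (s \<cdot> (t \<cdot> (star t \<cdot> star s))) = t \<cdot> (star t \<cdot> star s)"
    using idem_commute[OF _ mul_star_idem[OF assms(2)] _ star_mul_idem[OF assms(1)],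
        THEN arg_cong[of _ _ "\<lambda>z. z \<cdot> t"]]
      idem_commute[OF _ mul_star_idem[OF assms(2)] _ star_mul_idem[OF assms(1)],
        THEN arg_cong[of _ _ "\<lambda>z. z \<cdot> star s"]] assms
    by (simp_all add: mul_assoc)
  then show "s \<cdot> t \<cdot> (star t \<cdot> star s) \<cdot> (s \<cdot> t) = s \<cdot> t"
    "star t \<cdot> star s \<cdot> (s \<cdot> t) \<cdot> (star t \<cdot> star s) = star t \<cdot> star s"
    using assms by (simp_all add: mul_assoc)
qed (use assms in simp_all)

section \<open>The inverse semigroup of pairs\<close>

lemma translate_closed: "\<lbrakk>t \<in> carrier G; A \<subseteq> carrier G\<rbrakk> \<Longrightarrow> translate G t A \<subseteq> carrier G"
  by (auto simp: translate_def)

lemma translate_translate: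
  "\<lbrakk>s \<in> carrier G; t \<in> carrier G; A \<subseteq> carrier G\<rbrakk>
    \<Longrightarrow> translate G s (translate G t A) = translate G (s \<cdot> t) A"
  unfolding translate_def image_image by (intro image_cong) (auto simp: mul_assoc)

lemma translate_Un: "translate G t (A \<union> B) = translate G t A \<union> translate G t B"
  by (simp add: translate_def image_Un)

lemma translate_id: "(\<And>a. a \<in> A \<Longrightarrow> t \<cdot> a = a) \<Longrightarrow> translate G t A = A"
  by (simp add: translate_def)

text \<open>Every \<open>a\<close> is fixed by left multiplication with its range idempotent
  \<open>a \<cdot> star a\<close>, which here is \<open>t \<cdot> star t\<close>.\<close>

lemma range_cancel:
  assumes "a \<in> carrier G" "t \<in> carrier G" "a \<cdot> star a = t \<cdot> star t"
  shows "t \<cdot> star t \<cdot> a = a" "t \<cdot> (star t \<cdot> a) = a"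
  using assms mul_star_mul(1)[OF assms(1)] by (simp_all add: mul_assoc[symmetric])

lemma pairs_carrier:
  "(A, t) \<in> carrier (pairs G) \<longleftrightarrow> finite A \<and> A \<subseteq> carrier G \<and> t \<in> carrier G \<and> t \<in> A \<and>
    t \<cdot> star t \<in> A \<and> (\<forall>s\<in>A. s \<cdot> star s = t \<cdot> star t)"
  by (simp add: pairs_def)

lemma pairs_mul:
  "(A, t) \<cdot>\<^bsub>pairs G\<^esub> (B, s) =
    (translate G (t \<cdot> s \<cdot> star s \<cdot> star t) A \<union> translate G t B, t \<cdot> s)"
  by (simp add: pairs_def)

lemma pairs_translate_id:
  assumes "(A, t) \<in> carrier (pairs G)"
  shows "translate G (t \<cdot> star t) A = A"
  using assms unfolding pairs_carrier by (intro translate_id range_cancel) blast+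

text \<open>The range idempotent of \<open>t \<cdot> a\<close> is the conjugate by \<open>t\<close>
  of that of \<open>a\<close>. Hence a translate of a set with constant range again has constant
  range.\<close>

lemma conj_range:
  assumes "t \<in> carrier G" "s \<in> carrier G" "a \<in> carrier G" "a \<cdot> star a = s \<cdot> star s"
  shows "t \<cdot> a \<cdot> star (t \<cdot> a) = t \<cdot> (s \<cdot> (star s \<cdot> star t))"
  using assms(1-3) arg_cong[OF assms(4), of "\<lambda>z. t \<cdot> (z \<cdot> star t)"] by (simp add: mul_assoc)

lemma pairs_mul_closed:
  assumes "(A, t) \<in> carrier (pairs G)" "(B, s) \<in> carrier (pairs G)"
  shows "(A, t) \<cdot>\<^bsub>pairs G\<^esub> (B, s) \<in> carrier (pairs G)"
proof -
  have A: "finite A" "A \<subseteq> carrier G" "t \<in> carrier G" "t \<cdot> star t \<in> A"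
    and B: "finite B" "B \<subseteq> carrier G" "s \<in> carrier G" "s \<in> B"
    and Ar: "\<And>a. a \<in> A \<Longrightarrow> a \<cdot> star a = t \<cdot> star t"
    and Br: "\<And>b. b \<in> B \<Longrightarrow> b \<cdot> star b = s \<cdot> star s"
    using assms unfolding pairs_carrier by blast+
  let ?e = "t \<cdot> s \<cdot> star s \<cdot> star t"
  let ?r = "t \<cdot> s \<cdot> star (t \<cdot> s)"
  have "t \<cdot> s \<in> translate G t B" using B by (simp add: translate_def)
  \<comment> \<open>The range idempotent of the product is found in the first translate, as the
    image of \<open>t \<cdot> star t\<close>.\<close>
  moreover have "?r = ?e \<cdot> (t \<cdot> star t)"
    using A B by (simp add: mul_assoc)
  then have "?r \<in> translate G ?e A"
    using A(4) unfolding translate_def by blast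
  moreover have "?e \<cdot> a \<cdot> star (?e \<cdot> a) = ?r" if "a \<in> A" for a
  proof -
    have "?e \<cdot> a \<cdot> star (?e \<cdot> a) = ?e \<cdot> (t \<cdot> (star t \<cdot> star ?e))"
      using A B that by (intro conj_range[OF _ _ _ Ar]) auto
    also have "\<dots> = ?r" using A B by (simp add: mul_assoc)
    finally show ?thesis .
  qed
  moreover have "t \<cdot> b \<cdot> star (t \<cdot> b) = ?r" if "b \<in> B" for b
  proof -
    have "t \<cdot> b \<cdot> star (t \<cdot> b) = t \<cdot> (s \<cdot> (star s \<cdot> star t))"
      using A B that by (intro conj_range[OF _ _ _ Br]) auto
    also have "\<dots> = ?r" using A B by (simp add: mul_assoc)
    finally show ?thesis .
  qed
  ultimately have "\<forall>x\<in>translate G ?e A \<union> translate G t B. x \<cdot> star x = ?r"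
    "t \<cdot> s \<in> translate G ?e A \<union> translate G t B" "?r \<in> translate G ?e A \<union> translate G t B"
    unfolding translate_def by blast+
  moreover have "finite (translate G ?e A \<union> translate G t B)"
    using A B by (simp add: translate_def)
  moreover have "translate G ?e A \<union> translate G t B \<subseteq> carrier G"
    using A B translate_closed[of t B] translate_closed[of ?e A] by simp
  ultimately show ?thesis
    using A B unfolding pairs_mul pairs_carrier by blast
qed

lemma pairs_mul_assoc:
  assumes "(A, t) \<in> carrier (pairs G)" "(B, s) \<in> carrier (pairs G)" "(C, r) \<in> carrier (pairs G)"
  shows "(A, t) \<cdot>\<^bsub>pairs G\<^esub> (B, s) \<cdot>\<^bsub>pairs G\<^esub> (C, r) =
    (A, t) \<cdot>\<^bsub>pairs G\<^esub> ((B, s) \<cdot>\<^bsub>pairs G\<^esub> (C, r))"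
proof -
  have *: "A \<subseteq> carrier G" "t \<in> carrier G" "B \<subseteq> carrier G" "s \<in> carrier G"
     "C \<subseteq> carrier G" "r \<in> carrier G"
    using assms by (simp_all add: pairs_carrier)
  \<comment> \<open>Both bracketings give a union of translates of \<open>A\<close>,
    \<open>B\<close> and \<open>C\<close>. This equation matches the factors translating
    \<open>A\<close>, the next one those translating \<open>B\<close>; those of \<open>C\<close>
    agree by associativity.\<close>
  have 1: "t \<cdot> s \<cdot> r \<cdot> star r \<cdot> star (t \<cdot> s) \<cdot> (t \<cdot> s \<cdot> star s \<cdot> star t) =
      t \<cdot> (s \<cdot> r) \<cdot> star (s \<cdot> r) \<cdot> star t"
    using * conj_cancel(3)[of t "s \<cdot> r" "s \<cdot> (star s \<cdot> star t)"] by (simp add: mul_assoc)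
  have 2: "t \<cdot> s \<cdot> r \<cdot> star r \<cdot> star (t \<cdot> s) \<cdot> t = t \<cdot> (s \<cdot> r \<cdot> star r \<cdot> star s)"
    using * conj_cancel(1)[of t "s \<cdot> r"] by (simp add: mul_assoc)
  show ?thesis
    unfolding pairs_mul translate_Un using * 1 2
    by (simp add: translate_translate Un_assoc mul_assoc del: star_mul)
qed

lemma semigrp_pairs: "semigrp (pairs G)"
proof
  show "x \<cdot>\<^bsub>pairs G\<^esub> y \<in> carrier (pairs G)"
    if "x \<in> carrier (pairs G)" "y \<in> carrier (pairs G)" for x y
    using that pairs_mul_closed by (cases x; cases y) blast
  show "x \<cdot>\<^bsub>pairs G\<^esub> y \<cdot>\<^bsub>pairs G\<^esub> z = x \<cdot>\<^bsub>pairs G\<^esub> (y \<cdot>\<^bsub>pairs G\<^esub> z)"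
    if "x \<in> carrier (pairs G)" "y \<in> carrier (pairs G)" "z \<in> carrier (pairs G)" for x y z
    using that pairs_mul_assoc by (cases x; cases y; cases z) blast
qed

text \<open>The pair in the conclusion will turn out to be the inverse of
  \<open>(A, t)\<close>.\<close>

lemma pairs_star_closed:
  assumes "(A, t) \<in> carrier (pairs G)"
  shows "(translate G (star t) A, star t) \<in> carrier (pairs G)"
proof -
  have A: "finite A" "A \<subseteq> carrier G" "t \<in> carrier G" "t \<in> A" "t \<cdot> star t \<in> A"
    and Ar: "\<And>a. a \<in> A \<Longrightarrow> a \<cdot> star a = t \<cdot> star t"
    using assms unfolding pairs_carrier by blast+
  have "star t \<cdot> a \<cdot> star (star t \<cdot> a) = star t \<cdot> star (star t)" if "a \<in> A" for a
  proof -
    have "star t \<cdot> a \<cdot> star (star t \<cdot> a) = star t \<cdot> (t \<cdot> (star t \<cdot> star (star t)))"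
      using A that by (intro conj_range[OF _ _ _ Ar]) auto
    then show ?thesis using A by simp
  qed
  \<comment> \<open>The two elements that the first component must contain are the translates of
    \<open>t \<cdot> star t\<close> and of \<open>t\<close>.\<close>
  moreover have "star t = star t \<cdot> (t \<cdot> star t)" "star t \<cdot> star (star t) = star t \<cdot> t"
    using A by simp_all
  ultimately show ?thesis
    using A translate_closed[of "star t" A] unfolding pairs_carrier translate_def by blast
qed

text \<open>Translation by \<open>t \<cdot> star t\<close> fixes both \<open>A\<close> and
  \<open>translate G t B\<close>, so the first components simply unite. The formula serves for
  existence and for uniqueness of inverses.\<close>

lemma pairs_mul_translate:
  assumes "(A, t) \<in> carrier (pairs G)" "B \<subseteq> carrier G"
  shows "(A, t) \<cdot>\<^bsub>pairs G\<^esub> (B, star t) \<cdot>\<^bsub>pairs G\<^esub> (A, t) = (A \<union> translate G t B, t)"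
proof -
  have A: "A \<subseteq> carrier G" "t \<in> carrier G" using assms unfolding pairs_carrier by blast+
  have e: "t \<cdot> star t \<cdot> star (star t) \<cdot> star t = t \<cdot> star t"
    "t \<cdot> star t \<cdot> star (t \<cdot> star t) = t \<cdot> star t" "t \<cdot> star t \<cdot> t = t"
    using A by (simp_all add: mul_assoc)
  have "translate G (t \<cdot> star t) (translate G t B) = translate G t B"
    using A assms(2) by (simp add: translate_translate mul_assoc)
  then show ?thesis
    unfolding pairs_mul e translate_Un pairs_translate_id[OF assms(1)] by blast
qed

lemma pairs_mul_star_mul:
  assumes "(A, t) \<in> carrier (pairs G)"
  shows "(A, t) \<cdot>\<^bsub>pairs G\<^esub> (translate G (star t) A, star t) \<cdot>\<^bsub>pairs G\<^esub> (A, t) = (A, t)"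
proof -
  have A: "A \<subseteq> carrier G" "t \<in> carrier G" using assms unfolding pairs_carrier by blast+
  then have "translate G t (translate G (star t) A) = A"
    by (simp add: translate_translate pairs_translate_id[OF assms])
  then show ?thesis
    using pairs_mul_translate[OF assms translate_closed, of "star t" A] A by simp
qed

lemma pairs_translate_star:
  assumes "(A, t) \<in> carrier (pairs G)"
  shows "translate G (star (star t)) (translate G (star t) A) = A"
proof -
  have A: "A \<subseteq> carrier G" "t \<in> carrier G" using assms unfolding pairs_carrier by blast+
  then show ?thesis
    by (simp add: translate_translate pairs_translate_id[OF assms])
qed

lemma inverse_semigrp_pairs: "inverse_semigrp (pairs G)"
proof (intro inverse_semigrp.intro semigrp_pairs inverse_semigrp_axioms.intro)
  fix x assume x: "x \<in> carrier (pairs G)"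
  obtain A t where xA: "x = (A, t)" by (cases x)
  note A = x[unfolded xA]
  then have t: "t \<in> carrier G" "A \<subseteq> carrier G" unfolding pairs_carrier by blast+
  let ?y = "(translate G (star t) A, star t)"
  show "\<exists>!y. y \<in> carrier (pairs G) \<and> x \<cdot>\<^bsub>pairs G\<^esub> y \<cdot>\<^bsub>pairs G\<^esub> x = x \<and>
      y \<cdot>\<^bsub>pairs G\<^esub> x \<cdot>\<^bsub>pairs G\<^esub> y = y"
  proof (rule ex1I[of _ ?y])
    show "?y \<in> carrier (pairs G) \<and> x \<cdot>\<^bsub>pairs G\<^esub> ?y \<cdot>\<^bsub>pairs G\<^esub> x = x \<and>
      ?y \<cdot>\<^bsub>pairs G\<^esub> x \<cdot>\<^bsub>pairs G\<^esub> ?y = ?y"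
      using pairs_star_closed[OF A] pairs_mul_star_mul[OF A]
        pairs_mul_star_mul[OF pairs_star_closed[OF A], unfolded pairs_translate_star[OF A]]
        t unfolding xA by simp
  next
    fix y assume y: "y \<in> carrier (pairs G) \<and> x \<cdot>\<^bsub>pairs G\<^esub> y \<cdot>\<^bsub>pairs G\<^esub> x = x \<and>
      y \<cdot>\<^bsub>pairs G\<^esub> x \<cdot>\<^bsub>pairs G\<^esub> y = y"
    obtain B s where yB: "y = (B, s)" by (cases y)
    have B: "(B, s) \<in> carrier (pairs G)" using y yB by simp
    then have s: "s \<in> carrier G" "B \<subseteq> carrier G" unfolding pairs_carrier by blast+
    \<comment> \<open>The second components force \<open>s = star t\<close>. The first components
      then give an inclusion each, and translating \<open>AB\<close> by \<open>s\<close> turns it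
      into the reverse of the other one.\<close>
    have "t \<cdot> s \<cdot> t = t" "s \<cdot> t \<cdot> s = s"
      using y unfolding xA yB pairs_mul by simp_all
    then have st: "s = star t" using star_unique[OF t(1) s(1)] by simp
    have "(A, t) = (A \<union> translate G t B, t)"
      using y pairs_mul_translate[OF A s(2)] unfolding xA yB st by simp
    then have AB: "translate G t B \<subseteq> A" by auto
    have "(B, s) = (B \<union> translate G s A, s)"
      using y pairs_mul_translate[OF B t(2)] t unfolding xA yB st by simp
    then have "translate G s A \<subseteq> B" by auto
    moreover have "translate G s (translate G t B) = B"
      using pairs_translate_star[OF B] t by (simp add: st translate_translate s)
    then have "B \<subseteq> translate G s A"
      using image_mono[OF AB, of "\<lambda>b. s \<cdot> b"] unfolding translate_def by simp
    ultimately show "y = ?y" unfolding yB st by simp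
  qed
qed

section \<open>The canonical partial homomorphism into the pairs\<close>

lemma pair_rep_closed: "t \<in> carrier G \<Longrightarrow> pair_rep G t \<in> carrier (pairs G)"
  by (auto simp: pair_rep_def pairs_carrier mul_assoc)

lemma translate_insert: "translate G t (insert a B) = insert (t \<cdot> a) (translate G t B)"
  by (simp add: translate_def)

lemma translate_empty: "translate G t {} = {}"
  by (simp add: translate_def)

lemma partial_hom_pair_rep: "partial_hom G (pairs G) (pair_rep G)"
proof -
  interpret P: semigrp "pairs G" by (rule semigrp_pairs)
  note simps = pair_rep_def pairs_mul translate_insert translate_empty translate_Un mul_assoc
  show ?thesis
    unfolding partial_hom_def
  proof (intro conjI ballI)
    show "pair_rep G \<in> carrier G \<rightarrow> carrier (pairs G)" using pair_rep_closed by blast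
    fix s t assume st: "s \<in> carrier G" "t \<in> carrier G"
    show "pair_rep G s \<cdot>\<^bsub>pairs G\<^esub> pair_rep G t \<cdot>\<^bsub>pairs G\<^esub> pair_rep G (star t) =
        pair_rep G (s \<cdot> t) \<cdot>\<^bsub>pairs G\<^esub> pair_rep G (star t)"
      using st by (auto simp: simps)
    have "pair_rep G (star s) \<cdot>\<^bsub>pairs G\<^esub> (pair_rep G s \<cdot>\<^bsub>pairs G\<^esub> pair_rep G t) =
        pair_rep G (star s) \<cdot>\<^bsub>pairs G\<^esub> pair_rep G (s \<cdot> t)"
      using st by (auto simp: simps)
    then show "pair_rep G (star s) \<cdot>\<^bsub>pairs G\<^esub> pair_rep G s \<cdot>\<^bsub>pairs G\<^esub> pair_rep G t =
        pair_rep G (star s) \<cdot>\<^bsub>pairs G\<^esub> pair_rep G (s \<cdot> t)"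
      using st by (simp add: P.mul_assoc pair_rep_closed)
    show "pair_rep G s \<cdot>\<^bsub>pairs G\<^esub> pair_rep G (star s) \<cdot>\<^bsub>pairs G\<^esub> pair_rep G s = pair_rep G s"
      using st by (auto simp: simps)
  qed
qed

end

section \<open>Calculus of an arbitrary partial homomorphism\<close>

text \<open>The calculus is set up for a general target because it is instantiated twice: with
  \<open>gen G\<close> into \<open>Pr G\<close> and with \<open>pair_rep G\<close> into
  \<open>pairs G\<close>.\<close>

locale partial_homomorphism = inverse_semigrp G + T: semigrp T
  for G :: "('a, 'c) magma_scheme" (structure) and T :: "('b, 'd) magma_scheme" +
  fixes p assumes partial_hom: "partial_hom G T p"
begin

abbreviation tmul (infixl "\<odot>" 70) where "x \<odot> y \<equiv> x \<cdot>\<^bsub>T\<^esub> y"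

abbreviation \<epsilon> where "\<epsilon> s \<equiv> p s \<odot> p (star s)"

lemma p_closed [simp, intro]: "s \<in> carrier G \<Longrightarrow> p s \<in> carrier T"
  using partial_hom by (auto simp: partial_hom_def)

text \<open>The second and fourth equations are the defining relations at \<open>star t\<close> and
  \<open>star s\<close>, rewritten by \<open>star_star\<close>.\<close>

lemma p_rel:
  assumes "s \<in> carrier G" "t \<in> carrier G"
  shows "p s \<odot> p t \<odot> p (star t) = p (s \<cdot> t) \<odot> p (star t)"
    and "p s \<odot> p (star t) \<odot> p t = p (s \<cdot> star t) \<odot> p t"
    and "p (star s) \<odot> p s \<odot> p t = p (star s) \<odot> p (s \<cdot> t)"
    and "p s \<odot> p (star s) \<odot> p t = p s \<odot> p (star s \<cdot> t)"
    and "p s \<odot> p (star s) \<odot> p s = p s"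
proof -
  have *: "p a \<odot> p b \<odot> p (star b) = p (a \<cdot> b) \<odot> p (star b)"
    "p (star a) \<odot> p a \<odot> p b = p (star a) \<odot> p (a \<cdot> b)" "p a \<odot> p (star a) \<odot> p a = p a"
    if "a \<in> carrier G" "b \<in> carrier G" for a b
    using partial_hom that unfolding partial_hom_def by blast+
  show "p s \<odot> p t \<odot> p (star t) = p (s \<cdot> t) \<odot> p (star t)"
    "p s \<odot> p (star t) \<odot> p t = p (s \<cdot> star t) \<odot> p t"
    "p (star s) \<odot> p s \<odot> p t = p (star s) \<odot> p (s \<cdot> t)"
    "p s \<odot> p (star s) \<odot> p t = p s \<odot> p (star s \<cdot> t)"
    "p s \<odot> p (star s) \<odot> p s = p s"
    using *[OF assms] *[of s "star t"] *[of "star s" t] assms by simp_all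
qed

text \<open>As \<open>star e = e\<close>, the product of three copies of \<open>p e\<close> equals
  \<open>p e \<odot> p e\<close> by \<open>p_rel(3)\<close> and \<open>p e\<close> by
  \<open>p_rel(5)\<close>.\<close>

lemma p_idem:
  assumes e: "e \<in> carrier G" "e \<cdot> e = e"
  shows "p e \<odot> p e = p e"
  using p_rel(3,5)[of e] e idem_star[OF e] by metis

text \<open>With \<open>u = t \<cdot> e\<close>, duplicating \<open>p e\<close> gives
  \<open>p u \<odot> p e\<close>. Expanding \<open>p u\<close> to
  \<open>p u \<odot> p (star u) \<odot> p u\<close> then lets \<open>p_rel(3)\<close> absorb
  \<open>p e\<close>, because \<open>u \<cdot> e = u\<close>.\<close>

lemma p_mul_idem:
  assumes t: "t \<in> carrier G" and e: "e \<in> carrier G" "e \<cdot> e = e"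
  shows "p t \<odot> p e = p (t \<cdot> e)"
proof -
  let ?u = "t \<cdot> e"
  have "p t \<odot> p e = p ?u \<odot> p e"
    using p_rel(1)[OF t e(1)] e t p_idem[OF e] by (simp add: idem_star T.mul_assoc)
  also have "\<dots> = p ?u \<odot> p (star ?u) \<odot> p ?u \<odot> p e"
    using p_rel(5)[of ?u] t e by (simp del: star_mul)
  also have "\<dots> = p ?u \<odot> (p (star ?u) \<odot> p ?u \<odot> p e)"
    using t e by (simp add: T.mul_assoc)
  also have "\<dots> = p ?u \<odot> (p (star ?u) \<odot> p (?u \<cdot> e))"
    using p_rel(3)[of ?u e] t e by simp
  also have "\<dots> = p ?u"
    using p_rel(5)[of ?u] t e by (simp del: star_mul add: mul_assoc T.mul_assoc)
  finally show ?thesis .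
qed

text \<open>Mirror image of \<open>p_mul_idem\<close>: after the same expansion \<open>p e\<close>
  is absorbed from the left, because \<open>e \<cdot> u = u\<close> for
  \<open>u = e \<cdot> t\<close>.\<close>

lemma p_idem_mul:
  assumes t: "t \<in> carrier G" and e: "e \<in> carrier G" "e \<cdot> e = e"
  shows "p e \<odot> p t = p (e \<cdot> t)"
proof -
  let ?u = "e \<cdot> t"
  have eu: "e \<cdot> ?u = ?u" using t e by (simp add: mul_assoc[symmetric])
  have "p e \<odot> p t = p e \<odot> p ?u"
    using p_rel(3)[OF e(1) t] e t p_idem[OF e] by (simp add: idem_star)
  also have "\<dots> = p e \<odot> (p ?u \<odot> p (star ?u) \<odot> p ?u)"
    using p_rel(5)[of ?u] t e by (simp del: star_mul)
  also have "\<dots> = p e \<odot> p ?u \<odot> p (star ?u) \<odot> p ?u"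
    using t e by (simp add: T.mul_assoc)
  also have "\<dots> = p ?u \<odot> p (star ?u) \<odot> p ?u"
    using p_rel(1)[of e ?u] t e by (simp del: star_mul add: eu)
  also have "\<dots> = p ?u"
    using p_rel(5)[of ?u] t e by (simp del: star_mul)
  finally show ?thesis .
qed

section \<open>The commuting idempotents \<epsilon> and their products\<close>

lemma eps_closed [simp, intro]: "s \<in> carrier G \<Longrightarrow> \<epsilon> s \<in> carrier T"
  by simp

lemma eps_idem: "s \<in> carrier G \<Longrightarrow> \<epsilon> s \<odot> \<epsilon> s = \<epsilon> s"
  using p_rel(5)[of s] by (simp add: T.mul_assoc[symmetric])

lemma eps_mul: "s \<in> carrier G \<Longrightarrow> \<epsilon> s \<odot> p s = p s"
  by (rule p_rel)

text \<open>Expanding \<open>p s\<close> to \<open>p s \<odot> p (star s) \<odot> p s\<close>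
  creates the factor \<open>p (star s)\<close> under which \<open>p s \<odot> p t\<close> may be
  merged.\<close>

lemma p_mul:
  assumes "s \<in> carrier G" "t \<in> carrier G"
  shows "p s \<odot> p t = \<epsilon> s \<odot> p (s \<cdot> t)"
proof -
  have "p s \<odot> p t = p s \<odot> (p (star s) \<odot> p s \<odot> p t)"
    using eps_mul[OF assms(1)] assms by (simp add: T.mul_assoc[symmetric])
  then show ?thesis using assms p_rel(3)[OF assms] by (simp add: T.mul_assoc)
qed

lemma p_mul_eps:
  assumes "t \<in> carrier G" "s \<in> carrier G"
  shows "p t \<odot> \<epsilon> s = \<epsilon> (t \<cdot> s) \<odot> p t"
proof -
  let ?u = "t \<cdot> s"
  have "p t \<odot> \<epsilon> s = p ?u \<odot> p (star s)"
    using p_rel(1)[OF assms] assms by (simp add: T.mul_assoc)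
  also have "\<dots> = p ?u \<odot> (p (star ?u) \<odot> p ?u \<odot> p (star s))"
    using p_rel(5)[of ?u] assms by (simp del: star_mul add: T.mul_assoc[symmetric])
  also have "\<dots> = p ?u \<odot> (p (star ?u) \<odot> p (?u \<cdot> star s))"
    using p_rel(3)[of ?u "star s"] assms by (simp del: star_mul)
  \<comment> \<open>Since \<open>s \<cdot> star s\<close> and \<open>star t \<cdot> t\<close>
    commute, \<open>?u \<cdot> star s = ?u \<cdot> (star ?u \<cdot> t)\<close>. Splitting off
    \<open>?u\<close> and then \<open>star ?u\<close> leaves \<open>p t\<close> as the last
    factor.\<close>
  also have "p (star ?u) \<odot> p (?u \<cdot> star s) = p (star ?u) \<odot> p ?u \<odot> p (star ?u) \<odot> p t"
    using p_rel(3)[of ?u "star ?u \<cdot> t"] p_rel(4)[of "star ?u" t] assms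
      p_rel(4)[of ?u t]
    by (simp add: mul_assoc T.mul_assoc)
  also have "p (star ?u) \<odot> p ?u \<odot> p (star ?u) = p (star ?u)"
    using p_rel(5)[of "star ?u"] assms by simp
  finally show ?thesis using assms by (simp add: T.mul_assoc)
qed

lemma eps_mul_idem:
  assumes t: "t \<in> carrier G" and e: "e \<in> carrier G" "e \<cdot> e = e"
  shows "\<epsilon> (e \<cdot> t) = p e \<odot> \<epsilon> t" "\<epsilon> t \<odot> p e = p e \<odot> \<epsilon> t"
proof -
  have es: "star e = e" by (rule idem_star[OF e])
  \<comment> \<open>The conjugate of \<open>e\<close> carries it through
    \<open>\<epsilon> t\<close>: the equations \<open>tf\<close> turn \<open>e\<close> to the right
    of \<open>star t\<close> into \<open>?f\<close> between the two factors, and then into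
    \<open>e\<close> to the left of \<open>t\<close>.\<close>
  let ?f = "star t \<cdot> e \<cdot> t"
  have tf: "t \<cdot> ?f = e \<cdot> t" "?f \<cdot> star t = star t \<cdot> e"
    using idem_commute[OF e _ mul_star_idem[OF t], THEN arg_cong[of _ _ "\<lambda>z. z \<cdot> t"]]
      idem_commute[OF e _ mul_star_idem[OF t], THEN arg_cong[of _ _ "\<lambda>z. star t \<cdot> z"]]
      t e by (simp_all add: mul_assoc)
  have "?f \<cdot> ?f = star t \<cdot> e \<cdot> (t \<cdot> ?f)" using t e by (simp add: mul_assoc)
  also have "\<dots> = star t \<cdot> (e \<cdot> e) \<cdot> t" unfolding tf using t e(1) by (simp add: mul_assoc)
  finally have f: "?f \<in> carrier G" "?f \<cdot> ?f = ?f" using t e by simp_all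
  have "\<epsilon> t \<odot> p e = p t \<odot> p (?f \<cdot> star t)"
    unfolding tf using p_mul_idem[of "star t" e] t e by (simp add: T.mul_assoc)
  also have "\<dots> = p t \<odot> p ?f \<odot> p (star t)"
    using p_idem_mul[OF _ f, of "star t"] t e f by (simp add: T.mul_assoc)
  also have "p t \<odot> p ?f = p e \<odot> p t"
    unfolding p_mul_idem[OF t f] p_idem_mul[OF t e] tf ..
  also have "p e \<odot> p t \<odot> p (star t) = p e \<odot> \<epsilon> t"
    using t e by (simp add: T.mul_assoc)
  finally show 1: "\<epsilon> t \<odot> p e = p e \<odot> \<epsilon> t" .
  \<comment> \<open>Both factors of \<open>\<epsilon> (e \<cdot> t)\<close> release a
    \<open>p e\<close>, one on each side; commutation and idempotence merge the two.\<close>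
  have "\<epsilon> (e \<cdot> t) = p e \<odot> (\<epsilon> t \<odot> p e)"
    using p_mul_idem[of "star t" e] t e by (simp add: p_idem_mul[OF t e, symmetric] T.mul_assoc es)
  also have "\<dots> = p e \<odot> p e \<odot> \<epsilon> t" unfolding 1 using t e by (simp add: T.mul_assoc)
  finally show "\<epsilon> (e \<cdot> t) = p e \<odot> \<epsilon> t" using p_idem[OF e] by simp
qed

text \<open>Pushing \<open>p (star s)\<close> and then \<open>p s\<close> through
  \<open>\<epsilon> t\<close> by \<open>p_mul_eps\<close> replaces \<open>t\<close> by
  \<open>s \<cdot> star s \<cdot> t\<close>. The additional idempotent splits off as
  \<open>p (s \<cdot> star s)\<close> and is absorbed by \<open>p s\<close>.\<close>

lemma eps_commute:
  assumes s: "s \<in> carrier G" and t: "t \<in> carrier G"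
  shows "\<epsilon> s \<odot> \<epsilon> t = \<epsilon> t \<odot> \<epsilon> s"
proof -
  let ?e = "s \<cdot> star s"
  have e: "?e \<in> carrier G" "?e \<cdot> ?e = ?e" using s mul_star_idem by simp_all
  have "\<epsilon> s \<odot> \<epsilon> t = p s \<odot> (p (star s) \<odot> \<epsilon> t)"
    using s t by (simp add: T.mul_assoc)
  also have "\<dots> = p s \<odot> \<epsilon> (star s \<cdot> t) \<odot> p (star s)"
    using p_mul_eps[of "star s" t] s t by (simp add: T.mul_assoc del: star_mul)
  also have "\<dots> = \<epsilon> (?e \<cdot> t) \<odot> \<epsilon> s"
    using p_mul_eps[of s "star s \<cdot> t"] s t by (simp add: T.mul_assoc mul_assoc del: star_mul)
  also have "\<dots> = \<epsilon> t \<odot> (p ?e \<odot> p s) \<odot> p (star s)"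
    unfolding eps_mul_idem(1)[OF t e] eps_mul_idem(2)[OF t e, symmetric]
    using s t by (simp add: T.mul_assoc)
  also have "p ?e \<odot> p s = p s"
    using p_idem_mul[OF s e] s by (simp add: mul_assoc)
  finally show ?thesis using s t by (simp add: T.mul_assoc)
qed

text \<open>The target has no unit, so a product of \<epsilon> factors is represented by its left
  action: the empty list can then act as the identity and start inductions.\<close>

definition eps_act where "eps_act as x = foldr (\<lambda>a y. \<epsilon> a \<odot> y) as x"

lemma eps_act_simps [simp]:
  "eps_act [] x = x" "eps_act (a # as) x = \<epsilon> a \<odot> eps_act as x"
  "eps_act (as @ bs) x = eps_act as (eps_act bs x)"
  by (simp_all add: eps_act_def)

lemma eps_act_closed [simp, intro]:
  "\<lbrakk>set as \<subseteq> carrier G; x \<in> carrier T\<rbrakk> \<Longrightarrow> eps_act as x \<in> carrier T"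
  by (induction as) auto

lemma eps_mul_eps_act:
  "\<lbrakk>a \<in> carrier G; set as \<subseteq> carrier G; x \<in> carrier T\<rbrakk> \<Longrightarrow>
    \<epsilon> a \<odot> eps_act as x = eps_act as (\<epsilon> a \<odot> x)"
proof (induction as)
  case (Cons b as)
  have "\<epsilon> a \<odot> eps_act (b # as) x = \<epsilon> a \<odot> \<epsilon> b \<odot> eps_act as x"
    using Cons.prems T.mul_assoc[of "\<epsilon> a" "\<epsilon> b" "eps_act as x"] by simp
  also have "\<dots> = \<epsilon> b \<odot> \<epsilon> a \<odot> eps_act as x"
    using Cons.prems eps_commute[of a b] by simp
  also have "\<dots> = \<epsilon> b \<odot> (\<epsilon> a \<odot> eps_act as x)"
    using Cons.prems T.mul_assoc[of "\<epsilon> b" "\<epsilon> a" "eps_act as x"] by simp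
  finally show ?case using Cons by simp
qed simp

lemma eps_act_commute:
  "\<lbrakk>set as \<subseteq> carrier G; set bs \<subseteq> carrier G; x \<in> carrier T\<rbrakk> \<Longrightarrow>
    eps_act as (eps_act bs x) = eps_act bs (eps_act as x)"
  by (induction as) (auto simp: eps_mul_eps_act)

text \<open>Commutation carries \<open>\<epsilon> a\<close> to its own occurrence in the list, where
  idempotence swallows it.\<close>

lemma eps_act_absorb:
  assumes "a \<in> set as" "set as \<subseteq> carrier G" "x \<in> carrier T"
  shows "\<epsilon> a \<odot> eps_act as x = eps_act as x"
  using assms
proof (induction as)
  case (Cons b as)
  show ?case
  proof (cases "a = b")
    case True
    then show ?thesis
      using Cons.prems eps_idem[of a] T.mul_assoc[of "\<epsilon> a" "\<epsilon> a" "eps_act as x"] by simp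
  next
    case False
    have "\<epsilon> a \<odot> eps_act (b # as) x = eps_act [b] (\<epsilon> a \<odot> eps_act as x)"
      using Cons.prems eps_mul_eps_act[of a "[b]" "eps_act as x"] by auto
    then show ?thesis using Cons False by simp
  qed
qed simp

text \<open>Acting by both lists in succession equals acting by either, since each absorbs the other
  and the actions commute. Thus order and repetition are irrelevant and
  \<open>\<epsilon>\<^sub>A\<close> is well defined.\<close>

lemma eps_act_cong:
  assumes "set as = set bs" "set as \<subseteq> carrier G" "x \<in> carrier T"
  shows "eps_act as x = eps_act bs x"
proof -
  have *: "eps_act cs (eps_act ds x) = eps_act ds x"
    if "set cs \<subseteq> set ds" "set ds \<subseteq> carrier G" for cs ds
    using that assms(3) by (induction cs) (auto simp: eps_act_absorb)
  show ?thesis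
    using *[of as bs] *[of bs as] eps_act_commute[of as bs x] assms by simp
qed

lemma p_mul_eps_act:
  "\<lbrakk>s \<in> carrier G; set as \<subseteq> carrier G; x \<in> carrier T\<rbrakk> \<Longrightarrow>
    p s \<odot> eps_act as x = eps_act (map (\<lambda>a. s \<cdot> a) as) (p s \<odot> x)"
proof (induction as)
  case (Cons a as)
  have "p s \<odot> eps_act (a # as) x = p s \<odot> \<epsilon> a \<odot> eps_act as x"
    using Cons.prems T.mul_assoc[of "p s" "\<epsilon> a" "eps_act as x"] by simp
  also have "\<dots> = \<epsilon> (s \<cdot> a) \<odot> (p s \<odot> eps_act as x)"
    using Cons.prems T.mul_assoc[of "\<epsilon> (s \<cdot> a)" "p s" "eps_act as x"] p_mul_eps[of s a]
    by (simp del: star_mul)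
  finally show ?case using Cons by (simp del: star_mul)
qed simp

text \<open>Both \<epsilon> factors are absorbed by \<open>p s\<close>. This supplies the normal
  form of a single generator, with pair \<open>pair_rep G s\<close>.\<close>

lemma eps_act_pair_rep: "s \<in> carrier G \<Longrightarrow> eps_act [s \<cdot> star s, s] (p s) = p s"
proof -
  assume s: "s \<in> carrier G"
  then have "\<epsilon> (s \<cdot> star s) = p (s \<cdot> star s)"
    using p_idem[OF _ mul_star_idem[OF s]] by simp
  then show ?thesis
    using s p_idem_mul[OF s _ mul_star_idem[OF s]] eps_mul[OF s] by (simp add: mul_assoc)
qed

text \<open>The new list enumerates the first component of the product of
  \<open>pair_rep G s\<close> and \<open>(set as, t)\<close> in \<open>pairs G\<close>; this is the
  induction step for normal forms.\<close>

lemma p_mul_eps_act_p: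
  assumes s: "s \<in> carrier G" and t: "t \<in> carrier G" and as: "set as \<subseteq> carrier G"
  shows "p s \<odot> eps_act as (p t) =
    eps_act (map (\<lambda>a. s \<cdot> a) as @ [s \<cdot> t \<cdot> star t, s \<cdot> t \<cdot> star (s \<cdot> t)]) (p (s \<cdot> t))"
proof -
  let ?u = "s \<cdot> t"
  let ?e = "?u \<cdot> star ?u"
  have u: "?u \<in> carrier G" using s t by simp
  have e: "?e \<in> carrier G" "?e \<cdot> ?e = ?e" using u mul_star_idem[OF u] by (simp_all del: star_mul)
  have eu: "p ?e \<odot> p ?u = p ?u" "?e \<cdot> ?u = ?u"
    using p_idem_mul[OF u e] mul_star_mul(1)[OF u] by (simp_all del: star_mul)
  \<comment> \<open>The factor \<open>\<epsilon> s\<close> produced by \<open>p_mul\<close> may have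
    a range other than \<open>?e\<close>, which a normal form forbids. Replacing \<open>s\<close> by
    \<open>?e \<cdot> s\<close> repairs this at no cost, as \<open>p ?u\<close> absorbs
    \<open>p ?e\<close>.\<close>
  have "s \<cdot> t \<cdot> star t = ?e \<cdot> s" using s t by (simp add: mul_assoc)
  then have "\<epsilon> (s \<cdot> t \<cdot> star t) \<odot> p ?u = p ?e \<odot> \<epsilon> s \<odot> p ?u"
    using eps_mul_idem(1)[OF s e] by simp
  also have "\<dots> = \<epsilon> s \<odot> p ?u"
    unfolding eps_mul_idem(2)[OF s e, symmetric]
    using s u e eu by (simp add: T.mul_assoc del: star_mul)
  finally have "p s \<odot> p t = \<epsilon> (s \<cdot> t \<cdot> star t) \<odot> p ?u"
    using p_mul[OF s t] by simp
  moreover have "\<epsilon> ?e \<odot> p ?u = p ?u"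
    using u e eu p_idem[OF e] by (simp only: idem_star[OF e])
  ultimately have "p s \<odot> p t = eps_act [s \<cdot> t \<cdot> star t, ?e] (p ?u)"
    by simp
  then show ?thesis using p_mul_eps_act[OF s as, of "p t"] t by simp
qed

text \<open>Bridge from the nonempty products in the definition of normal forms to
  \<open>eps_act\<close>.\<close>

lemma list_prod_eps_mul:
  assumes "as \<noteq> []" "set as \<subseteq> carrier G" "x \<in> carrier T"
  shows "list_prod T (map (\<lambda>a. \<epsilon> a) as) \<odot> x = eps_act as x"
  using assms
proof (induction as rule: list_nonempty_induct)
  case (cons a as)
  have "list_prod T (map (\<lambda>a. \<epsilon> a) (a # as)) = \<epsilon> a \<odot> list_prod T (map (\<lambda>a. \<epsilon> a) as)"
    using cons(1) by (cases as) simp_all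
  moreover have "list_prod T (map (\<lambda>a. \<epsilon> a) as) \<in> carrier T"
    using list_prod_append[OF T.semigrp_axioms, of "map (\<lambda>a. \<epsilon> a) as" "[\<epsilon> a]"] cons.prems cons(1)
    by auto
  ultimately show ?case
    using cons T.mul_assoc[of "\<epsilon> a" "list_prod T (map (\<lambda>a. \<epsilon> a) as)" x] by simp
qed simp

end

section \<open>Existence of normal forms\<close>

context inverse_semigrp begin

lemma gen_closed [simp]: "s \<in> carrier G \<Longrightarrow> gen G s \<in> carrier (Pr G)"
  unfolding gen_def by (rule Pr_class_closed) (simp add: words_def)

lemma partial_homomorphism_gen: "partial_homomorphism G (Pr G) (gen G)"
  using inverse_semigrp_axioms semigrp_Pr partial_hom_gen
  by (intro partial_homomorphism.intro partial_homomorphism_axioms.intro)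

lemma partial_homomorphism_pair_rep: "partial_homomorphism G (pairs G) (pair_rep G)"
  using inverse_semigrp_axioms semigrp_pairs partial_hom_pair_rep
  by (intro partial_homomorphism.intro partial_homomorphism_axioms.intro)

interpretation Pr: partial_homomorphism G "Pr G" "gen G"
  by (rule partial_homomorphism_gen)

interpretation H: partial_homomorphism G "pairs G" "pair_rep G"
  by (rule partial_homomorphism_pair_rep)

text \<open>By \<open>eps_act_cong\<close>, \<open>remdups\<close> does not change the action of a
  list, so enumerations with repetitions are admissible too.\<close>

lemma is_normal_form_iff:
  "is_normal_form G x (A, t) \<longleftrightarrow> (A, t) \<in> carrier (pairs G) \<and>
    (\<exists>as. set as = A \<and> x = Pr.eps_act as (gen G t))"
proof (cases "(A, t) \<in> carrier (pairs G)")
  case True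
  then have A: "finite A" "A \<subseteq> carrier G" "t \<in> carrier G" "t \<in> A"
    unfolding pairs_carrier by blast+
  have "(\<exists>e. is_eps_set G A e \<and> x = e \<cdot>\<^bsub>Pr G\<^esub> gen G t) \<longleftrightarrow>
      (\<exists>as. distinct as \<and> set as = A \<and>
        x = list_prod (Pr G) (map (eps G) as) \<cdot>\<^bsub>Pr G\<^esub> gen G t)"
    unfolding is_eps_set_def by blast
  also have "\<dots> \<longleftrightarrow> (\<exists>as. distinct as \<and> set as = A \<and> x = Pr.eps_act as (gen G t))"
  proof -
    have "list_prod (Pr G) (map (eps G) as) \<cdot>\<^bsub>Pr G\<^esub> gen G t = Pr.eps_act as (gen G t)"
      if "set as = A" for as
      unfolding eps_def[abs_def] using that A by (intro Pr.list_prod_eps_mul) auto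
    then show ?thesis by (intro ex_cong1) auto
  qed
  also have "\<dots> \<longleftrightarrow> (\<exists>as. set as = A \<and> x = Pr.eps_act as (gen G t))"
  proof
    assume "\<exists>as. set as = A \<and> x = Pr.eps_act as (gen G t)"
    then obtain as where as: "set as = A" "x = Pr.eps_act as (gen G t)" by blast
    then have "x = Pr.eps_act (remdups as) (gen G t)"
      using Pr.eps_act_cong[of "remdups as" as "gen G t"] A by simp
    then show "\<exists>as. distinct as \<and> set as = A \<and> x = Pr.eps_act as (gen G t)"
      using as(1) by (intro exI[of _ "remdups as"]) simp
  qed blast
  finally show ?thesis
    using True unfolding is_normal_form_def pairs_carrier prod.case by blast
next
  case False
  then show ?thesis unfolding is_normal_form_def pairs_carrier prod.case by blast
qed

text \<open>Induction on a word representing \<open>x\<close>; prepending a letter is handled by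
  \<open>p_mul_eps_act_p\<close>.\<close>

lemma ex_normal_form:
  assumes "x \<in> carrier (Pr G)"
  shows "\<exists>A t. is_normal_form G x (A, t)"
proof -
  obtain w where w: "w \<noteq> []" "set w \<subseteq> carrier G" and x: "x = Pr_rel G `` {w}"
    using assms unfolding Pr_carrier words_def by blast
  from w show ?thesis unfolding x
  proof (induction w rule: list_nonempty_induct)
    case (single s)
    then have "Pr_rel G `` {[s]} = Pr.eps_act [s \<cdot> star s, s] (gen G s)"
      using Pr.eps_act_pair_rep[of s] by (simp add: gen_def)
    moreover have "(set [s \<cdot> star s, s], s) \<in> carrier (pairs G)"
      using pair_rep_closed[of s] single by (simp add: pair_rep_def)
    ultimately show ?case unfolding is_normal_form_iff by blast
  next
    case (cons s w)
    then obtain as t where as: "(set as, t) \<in> carrier (pairs G)"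
      and w: "Pr_rel G `` {w} = Pr.eps_act as (gen G t)"
      unfolding is_normal_form_iff by (metis insert_subset list.simps(15))
    have s: "s \<in> carrier G" and t: "t \<in> carrier G" "set as \<subseteq> carrier G" "t \<cdot> star t \<in> set as"
      using cons.prems as unfolding pairs_carrier list.set by blast+
    let ?bs = "map (\<lambda>a. s \<cdot> a) as @ [s \<cdot> t \<cdot> star t, s \<cdot> t \<cdot> star (s \<cdot> t)]"
    have "Pr_rel G `` {s # w} = gen G s \<cdot>\<^bsub>Pr G\<^esub> Pr_rel G `` {w}"
      using Pr_mul_class[of "[s]" w] cons by (simp add: gen_def words_def)
    also have "\<dots> = Pr.eps_act ?bs (gen G (s \<cdot> t))"
      unfolding w by (rule Pr.p_mul_eps_act_p[OF s t(1,2)])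
    finally have 1: "Pr_rel G `` {s # w} = Pr.eps_act ?bs (gen G (s \<cdot> t))" .
    \<comment> \<open>Recognising the pair as a product in \<open>pairs G\<close> yields all
      conditions on \<open>?bs\<close> from closure.\<close>
    have "pair_rep G s \<cdot>\<^bsub>pairs G\<^esub> (set as, t) = (set ?bs, s \<cdot> t)"
      using s t by (auto simp: pair_rep_def pairs_mul translate_def mul_assoc)
    then have "(set ?bs, s \<cdot> t) \<in> carrier (pairs G)"
      using pairs_mul_closed as pair_rep_closed[OF s] unfolding pair_rep_def by metis
    with 1 show ?case unfolding is_normal_form_iff by blast
  qed
qed

section \<open>Evaluation in the pairs, and uniqueness of normal forms\<close>

lemma pair_rep_mul_star:
  "a \<in> carrier G \<Longrightarrow>
    pair_rep G a \<cdot>\<^bsub>pairs G\<^esub> pair_rep G (star a) = ({a \<cdot> star a, a}, a \<cdot> star a)"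
  by (auto simp: pair_rep_def pairs_mul translate_def mul_assoc)

text \<open>The left factor has second component \<open>t \<cdot> star t\<close>, which fixes
  \<open>a\<close> and all of \<open>B\<close>. The first components therefore unite, and
  \<open>t \<cdot> star t\<close> is already in \<open>B\<close>.\<close>

lemma pairs_eps_mul:
  assumes "(B, t) \<in> carrier (pairs G)" "a \<in> carrier G" "a \<cdot> star a = t \<cdot> star t"
  shows "pair_rep G a \<cdot>\<^bsub>pairs G\<^esub> pair_rep G (star a) \<cdot>\<^bsub>pairs G\<^esub> (B, t) = (insert a B, t)"
proof -
  let ?e = "t \<cdot> star t"
  have t: "t \<in> carrier G" "?e \<in> B" using assms(1) unfolding pairs_carrier by blast+
  have e: "?e \<cdot> t \<cdot> star t \<cdot> star ?e = ?e" "?e \<cdot> t = t" "?e \<cdot> ?e = ?e"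
    using t by (simp_all add: mul_assoc)
  have "translate G ?e {?e, a} = {?e, a}"
    using e(3) range_cancel(1)[OF assms(2) t(1) assms(3)] by (simp add: translate_def)
  then show ?thesis
    using t e pairs_translate_id[OF assms(1)]
    by (auto simp: pair_rep_mul_star assms(2,3) pairs_mul)
qed

lemma pairs_eps_act:
  assumes "t \<in> carrier G" "set as \<subseteq> carrier G" "\<And>a. a \<in> set as \<Longrightarrow> a \<cdot> star a = t \<cdot> star t"
  shows "H.eps_act as (pair_rep G t) = (set as \<union> {t \<cdot> star t, t}, t)"
  using assms(2,3)
proof (induction as)
  case (Cons a as)
  have "H.eps_act as (pair_rep G t) = (set as \<union> {t \<cdot> star t, t}, t)"
    using Cons.prems by (intro Cons.IH) simp_all
  moreover have "H.eps_act as (pair_rep G t) \<in> carrier (pairs G)"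
    using Cons.prems assms(1) by (intro H.eps_act_closed H.p_closed) simp_all
  ultimately show ?case
    using Cons.prems by (simp add: pairs_eps_mul insert_commute)
qed (simp add: pair_rep_def)

lemma hom_eps_act:
  assumes f: "is_induced G (pairs G) (pair_rep G) f" and "set as \<subseteq> carrier G" "x \<in> carrier (Pr G)"
  shows "f (Pr.eps_act as x) = H.eps_act as (f x)"
proof -
  have hom: "f (y \<cdot>\<^bsub>Pr G\<^esub> z) = f y \<cdot>\<^bsub>pairs G\<^esub> f z"
    if "y \<in> carrier (Pr G)" "z \<in> carrier (Pr G)" for y z
    using f that unfolding is_induced_def semigrp_hom_def by blast
  have gen: "f (gen G s) = pair_rep G s" if "s \<in> carrier G" for s
    using f that unfolding is_induced_def by blast
  show ?thesis
    using assms(2,3) by (induction as) (simp_all add: hom gen)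
qed

text \<open>The value \<open>f x\<close> is independent of the choice of \<open>p\<close>, so this
  both makes normal forms unique and identifies \<open>f\<close> with
  \<open>nf_map G\<close>.\<close>

lemma induced_normal_form:
  assumes f: "is_induced G (pairs G) (pair_rep G) f" and x: "is_normal_form G x p"
  shows "f x = p"
proof -
  obtain A t where p: "p = (A, t)" by (cases p)
  from x obtain as where A: "(A, t) \<in> carrier (pairs G)" and as: "set as = A"
    and xe: "x = Pr.eps_act as (gen G t)"
    unfolding p is_normal_form_iff by blast
  have t: "t \<in> carrier G" "set as \<subseteq> carrier G" "t \<in> A" "t \<cdot> star t \<in> A"
    and At: "\<And>a. a \<in> set as \<Longrightarrow> a \<cdot> star a = t \<cdot> star t"
    using A unfolding pairs_carrier as by blast+
  have "f x = H.eps_act as (f (gen G t))"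
    unfolding xe using t by (intro hom_eps_act[OF f]) simp_all
  also have "f (gen G t) = pair_rep G t"
    using f t unfolding is_induced_def by blast
  also have "H.eps_act as (pair_rep G t) = (set as \<union> {t \<cdot> star t, t}, t)"
    by (rule pairs_eps_act[OF t(1,2) At])
  also have "\<dots> = p" using t unfolding p as by blast
  finally show ?thesis .
qed

text \<open>The two elements may come from different enumerations of one set, which
  \<open>eps_act_cong\<close> identifies. This is injectivity of \<open>nf_map G\<close>.\<close>

lemma normal_form_inject:
  assumes "is_normal_form G x p" "is_normal_form G y p"
  shows "x = y"
proof -
  obtain A t where p: "p = (A, t)" by (cases p)
  obtain as bs where A: "(A, t) \<in> carrier (pairs G)" "set as = A" "set bs = A"
    and xy: "x = Pr.eps_act as (gen G t)" "y = Pr.eps_act bs (gen G t)"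
    using assms unfolding p is_normal_form_iff by blast
  have "t \<in> carrier G" "A \<subseteq> carrier G" using A(1) unfolding pairs_carrier by blast+
  then show ?thesis unfolding xy using A by (intro Pr.eps_act_cong) simp_all
qed

lemma normal_form_surj:
  assumes "p \<in> carrier (pairs G)"
  shows "\<exists>x\<in>carrier (Pr G). is_normal_form G x p"
proof -
  obtain A t where p: "p = (A, t)" by (cases p)
  have A: "finite A" "A \<subseteq> carrier G" "t \<in> carrier G"
    using assms unfolding p pairs_carrier by blast+
  then obtain as where as: "set as = A" using finite_list by blast
  have "Pr.eps_act as (gen G t) \<in> carrier (Pr G)"
    using A as by (intro Pr.eps_act_closed) simp_all
  then show ?thesis using assms as unfolding p is_normal_form_iff by blast
qed

text \<open>An induced homomorphism exists by universality and equals every normal form of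
  \<open>x\<close>, so the description defining \<open>nf_map\<close> has a unique solution.\<close>

lemma nf_map_eqI: "is_normal_form G x p \<Longrightarrow> nf_map G x = p"
  using induced_normal_form Pr_universal(1)[OF semigrp_pairs partial_hom_pair_rep]
  unfolding nf_map_def by (intro the_equality) metis+

lemma induced_eq_nf_map:
  "\<lbrakk>is_induced G (pairs G) (pair_rep G) f; x \<in> carrier (Pr G)\<rbrakk> \<Longrightarrow> f x = nf_map G x"
  using ex_normal_form[of x] induced_normal_form nf_map_eqI by metis

lemma is_normal_form_nf_map: "x \<in> carrier (Pr G) \<Longrightarrow> is_normal_form G x (nf_map G x)"
  using ex_normal_form nf_map_eqI by metis

text \<open>\<open>nf_map G\<close> agrees on the carrier with an induced homomorphism, and being
  induced concerns only values there.\<close>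

lemma is_induced_nf_map: "is_induced G (pairs G) (pair_rep G) (nf_map G)"
proof -
  interpret S: semigrp "Pr G" by (rule semigrp_Pr)
  obtain f where f: "is_induced G (pairs G) (pair_rep G) f"
    using Pr_universal(1)[OF semigrp_pairs partial_hom_pair_rep] by blast
  then show ?thesis
    using induced_eq_nf_map[OF f] unfolding is_induced_def semigrp_hom_def
    by (auto simp: Pi_iff)
qed

lemma bij_betw_nf_map: "bij_betw (nf_map G) (carrier (Pr G)) (carrier (pairs G))"
  unfolding bij_betw_def
proof
  show "inj_on (nf_map G) (carrier (Pr G))"
    using is_normal_form_nf_map normal_form_inject by (metis inj_onI)
  show "nf_map G ` carrier (Pr G) = carrier (pairs G)"
  proof
    show "nf_map G ` carrier (Pr G) \<subseteq> carrier (pairs G)"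
      using is_induced_nf_map unfolding is_induced_def semigrp_hom_def by blast
    show "carrier (pairs G) \<subseteq> nf_map G ` carrier (Pr G)"
      using normal_form_surj nf_map_eqI by (metis image_eqI subsetI)
  qed
qed

end

theorem mainTheorem2:
  fixes G :: "('a, 'b) magma_scheme"
  assumes "inverse_semigrp G"
  shows "inverse_semigrp (pairs G) \<and>
    (\<forall>x\<in>carrier (Pr G). \<exists>!p. is_normal_form G x p) \<and>
    nf_map G \<in> semigrp_iso (Pr G) (pairs G) \<and>
    partial_hom G (pairs G) (pair_rep G) \<and>
    is_induced G (pairs G) (pair_rep G) (nf_map G) \<and>
    (\<forall>f. is_induced G (pairs G) (pair_rep G) f \<longrightarrow> (\<forall>x\<in>carrier (Pr G). f x = nf_map G x))"
proof -
  interpret inverse_semigrp G by fact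
  have "\<exists>!p. is_normal_form G x p" if "x \<in> carrier (Pr G)" for x
    using is_normal_form_nf_map[OF that] nf_map_eqI by metis
  moreover have "nf_map G \<in> semigrp_iso (Pr G) (pairs G)"
    using is_induced_nf_map bij_betw_nf_map unfolding is_induced_def semigrp_iso_def by blast
  ultimately show ?thesis
    using inverse_semigrp_pairs partial_hom_pair_rep is_induced_nf_map induced_eq_nf_map by blast
qed

end
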